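(* Let $\underline{B}=(B,\leq,0,1,+,C)$ be a distributive contact join-semilattice. Then there is a set $W$ with a reflexive and symmetric binary relation $R$ on $W$ and an isomorphic embedding of $\underline{B}$ into the structure $(2^W,\subseteq,\emptyset,W,\cup,C_R)$, where $a\,C_R\,b$ iff there exist $x\in a$ and $y\in b$ with $xRy$.
   Context: A distributive contact join-semilattice (DCJS) is a structure $(B,\leq,0,1,+,C)$ with $B$ a set, $0,1\in B$, $+$ a binary operation, and $\leq$, $C$ binary relations on $B$, satisfying for all elements: (1) $x\leq x$; (2) $x\leq y\wedge y\leq x\rightarrow x=y$; (3) $x\leq y\wedge y\leq z\rightarrow x\leq z$; (4) $x+y=y+x$; (5) $x\leq x+y$; (6) $x\leq z\wedge y\leq z\rightarrow x+y\leq z$; (7) $0\leq x$; (8) $x\leq 1$; (9) $xCy\rightarrow x\neq 0$; (10) $xCy\rightarrow yCx$; (11) $xC(y+z)\rightarrow xCy$ or $xCz$; (12) $xCy\wedge y\leq y'\rightarrow xCy'$; (13) $x\neq 0\rightarrow xCx$; (ad) if $x\leq a+b$ then there exist $a'\leq a$, $b'\leq b$ with $x=a'+b'$. An isomorphic embedding of $(B,\leq,0,1,+,C)$ into $(B',\leq',0',1',+',C')$ is an injective map $h$ with $h(0)=0'$, $h(1)=1'$, $h(a+b)=h(a)+'h(b)$, $a\leq b\iff h(a)\leq' h(b)$, and $aCb\iff h(a)C'h(b)$. *)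

theory Defs
  imports Main
begin

record 'a contact_structure =
  carrier :: "'a set"
  le :: "'a \<Rightarrow> 'a \<Rightarrow> bool" (infix "\<sqsubseteq>\<index>" 50)
  zero_el :: "'a" ("\<zero>\<index>")
  one_el :: "'a" ("\<one>\<index>")
  join :: "'a \<Rightarrow> 'a \<Rightarrow> 'a" (infixl "\<oplus>\<index>" 65)
  contact :: "'a \<Rightarrow> 'a \<Rightarrow> bool" (infix "\<frown>\<index>" 50)

text \<open>Distributive contact join-semilattices. The relations and the operation are constrained
  only on the carrier.\<close>

locale dcjs =
  fixes B :: "'a contact_structure" (structure)
  assumes zero_closed: "\<zero> \<in> carrier B"
    and one_closed: "\<one> \<in> carrier B"
    and join_closed: "\<lbrakk>x \<in> carrier B; y \<in> carrier B\<rbrakk> \<Longrightarrow> x \<oplus> y \<in> carrier B"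
    and le_refl: "x \<in> carrier B \<Longrightarrow> x \<sqsubseteq> x"
    and le_antisym: "\<lbrakk>x \<in> carrier B; y \<in> carrier B; x \<sqsubseteq> y; y \<sqsubseteq> x\<rbrakk> \<Longrightarrow> x = y"
    and le_trans: "\<lbrakk>x \<in> carrier B; y \<in> carrier B; z \<in> carrier B; x \<sqsubseteq> y; y \<sqsubseteq> z\<rbrakk> \<Longrightarrow> x \<sqsubseteq> z"
    and join_commute: "\<lbrakk>x \<in> carrier B; y \<in> carrier B\<rbrakk> \<Longrightarrow> x \<oplus> y = y \<oplus> x"
    and join_upper: "\<lbrakk>x \<in> carrier B; y \<in> carrier B\<rbrakk> \<Longrightarrow> x \<sqsubseteq> x \<oplus> y"
    and join_least:
      "\<lbrakk>x \<in> carrier B; y \<in> carrier B; z \<in> carrier B; x \<sqsubseteq> z; y \<sqsubseteq> z\<rbrakk> \<Longrightarrow> x \<oplus> y \<sqsubseteq> z"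
    and zero_le: "x \<in> carrier B \<Longrightarrow> \<zero> \<sqsubseteq> x"
    and le_one: "x \<in> carrier B \<Longrightarrow> x \<sqsubseteq> \<one>"
    and contact_nonzero: "\<lbrakk>x \<in> carrier B; y \<in> carrier B; x \<frown> y\<rbrakk> \<Longrightarrow> x \<noteq> \<zero>"
    and contact_sym: "\<lbrakk>x \<in> carrier B; y \<in> carrier B; x \<frown> y\<rbrakk> \<Longrightarrow> y \<frown> x"
    and contact_join:
      "\<lbrakk>x \<in> carrier B; y \<in> carrier B; z \<in> carrier B; x \<frown> (y \<oplus> z)\<rbrakk> \<Longrightarrow> x \<frown> y \<or> x \<frown> z"
    and contact_mono:
      "\<lbrakk>x \<in> carrier B; y \<in> carrier B; y' \<in> carrier B; x \<frown> y; y \<sqsubseteq> y'\<rbrakk> \<Longrightarrow> x \<frown> y'"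
    and contact_refl: "\<lbrakk>x \<in> carrier B; x \<noteq> \<zero>\<rbrakk> \<Longrightarrow> x \<frown> x"
    and distributive:
      "\<lbrakk>x \<in> carrier B; a \<in> carrier B; b \<in> carrier B; x \<sqsubseteq> a \<oplus> b\<rbrakk>
        \<Longrightarrow> \<exists>a' \<in> carrier B. \<exists>b' \<in> carrier B. a' \<sqsubseteq> a \<and> b' \<sqsubseteq> b \<and> x = a' \<oplus> b'"

definition iso_embedding ::
    "('a \<Rightarrow> 'b) \<Rightarrow> 'a contact_structure \<Rightarrow> 'b contact_structure \<Rightarrow> bool" where
  "iso_embedding h A B \<longleftrightarrow>
     (\<forall>a \<in> carrier A. h a \<in> carrier B) \<and>
     inj_on h (carrier A) \<and>
     h \<zero>\<^bsub>A\<^esub> = \<zero>\<^bsub>B\<^esub> \<and>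
     h \<one>\<^bsub>A\<^esub> = \<one>\<^bsub>B\<^esub> \<and>
     (\<forall>a \<in> carrier A. \<forall>b \<in> carrier A. h (a \<oplus>\<^bsub>A\<^esub> b) = h a \<oplus>\<^bsub>B\<^esub> h b) \<and>
     (\<forall>a \<in> carrier A. \<forall>b \<in> carrier A. a \<sqsubseteq>\<^bsub>A\<^esub> b \<longleftrightarrow> h a \<sqsubseteq>\<^bsub>B\<^esub> h b) \<and>
     (\<forall>a \<in> carrier A. \<forall>b \<in> carrier A. a \<frown>\<^bsub>A\<^esub> b \<longleftrightarrow> h a \<frown>\<^bsub>B\<^esub> h b)"

definition powerset_structure :: "'w set \<Rightarrow> 'w rel \<Rightarrow> 'w set contact_structure" where
  "powerset_structure W R =
     \<lparr>carrier = Pow W, le = (\<subseteq>), zero_el = {}, one_el = W, join = (\<union>),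
      contact = (\<lambda>a b. \<exists>x \<in> a. \<exists>y \<in> b. (x, y) \<in> R)\<rparr>"

end

theory Submission
  imports Defs
begin

text \<open>The points are the prime filters of \<open>B\<close>, that is, its proper down-directed prime up-sets, with
  two points related iff all their members are pairwise in contact. Distributivity makes the
  complement of an ideal maximal without a given element a prime filter; this separates elements.
  Given a contact of \<open>a\<close> and \<open>b\<close>, the elements not in contact with \<open>a\<close> form an ideal without \<open>b\<close>,
  which yields a prime filter \<open>y\<close> around \<open>b\<close>; the elements not in contact with some member of \<open>y\<close>
  form an ideal without \<open>a\<close>, which yields the prime filter around \<open>a\<close> related to \<open>y\<close>.\<close>

context dcjs
begin

section \<open>Ideals and prime filters\<close>

definition ideal :: "'a set \<Rightarrow> bool" where
  "ideal I \<longleftrightarrow> I \<subseteq> carrier B \<and> \<zero> \<in> I \<and>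
     (\<forall>x \<in> carrier B. \<forall>y \<in> I. x \<sqsubseteq> y \<longrightarrow> x \<in> I) \<and>
     (\<forall>x \<in> I. \<forall>y \<in> I. x \<oplus> y \<in> I)"

text \<open>As \<open>B\<close> has no meets, closure under meets is replaced by down-directedness:
  a common lower bound of two members must exist inside \<open>F\<close>.\<close>

definition prime_filter :: "'a set \<Rightarrow> bool" where
  "prime_filter F \<longleftrightarrow> F \<subseteq> carrier B \<and> \<one> \<in> F \<and> \<zero> \<notin> F \<and>
     (\<forall>x \<in> F. \<forall>y \<in> carrier B. x \<sqsubseteq> y \<longrightarrow> y \<in> F) \<and>
     (\<forall>x \<in> F. \<forall>y \<in> F. \<exists>z \<in> F. z \<sqsubseteq> x \<and> z \<sqsubseteq> y) \<and>
     (\<forall>x \<in> carrier B. \<forall>y \<in> carrier B. x \<oplus> y \<in> F \<longrightarrow> x \<in> F \<or> y \<in> F)"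

lemma join_upper2: "\<lbrakk>x \<in> carrier B; y \<in> carrier B\<rbrakk> \<Longrightarrow> y \<sqsubseteq> x \<oplus> y"
  using join_upper join_commute by metis

lemma join_mono:
  assumes "x \<in> carrier B" "y \<in> carrier B" "x' \<in> carrier B" "y' \<in> carrier B"
    and "x \<sqsubseteq> x'" "y \<sqsubseteq> y'"
  shows "x \<oplus> y \<sqsubseteq> x' \<oplus> y'"
proof (rule join_least)
  show "x \<sqsubseteq> x' \<oplus> y'" using assms join_upper join_closed le_trans by meson
  show "y \<sqsubseteq> x' \<oplus> y'" using assms join_upper2 join_closed le_trans by meson
qed (use assms join_closed in auto)

lemma ideal_principal:
  assumes b: "b \<in> carrier B"
  shows "ideal {x \<in> carrier B. x \<sqsubseteq> b}"
  unfolding ideal_def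
proof (intro conjI ballI impI)
  show "\<zero> \<in> {x \<in> carrier B. x \<sqsubseteq> b}" using b zero_closed zero_le by simp
next
  fix x y assume "x \<in> carrier B" "y \<in> {x \<in> carrier B. x \<sqsubseteq> b}" "x \<sqsubseteq> y"
  then show "x \<in> {x \<in> carrier B. x \<sqsubseteq> b}" using b le_trans by blast
next
  fix x y assume "x \<in> {x \<in> carrier B. x \<sqsubseteq> b}" "y \<in> {x \<in> carrier B. x \<sqsubseteq> b}"
  then show "x \<oplus> y \<in> {x \<in> carrier B. x \<sqsubseteq> b}" using b join_closed join_least by simp
qed auto

text \<open>This is the ideal generated by \<open>I\<close> and \<open>b\<close>, the extension to
  be played off against maximality. For closure under joins, the bounds \<open>i\<close> and
  \<open>j\<close> are both replaced by \<open>i \<oplus> j\<close>.\<close>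

lemma ideal_adjoin:
  assumes I: "ideal I" and b: "b \<in> carrier B"
  shows "ideal {x \<in> carrier B. \<exists>i \<in> I. x \<sqsubseteq> i \<oplus> b}"
  unfolding ideal_def
proof (intro conjI ballI impI)
  have sub: "I \<subseteq> carrier B" and zero: "\<zero> \<in> I" using I by (auto simp: ideal_def)
  show "\<zero> \<in> {x \<in> carrier B. \<exists>i \<in> I. x \<sqsubseteq> i \<oplus> b}"
    using zero zero_closed zero_le join_closed b by auto
next
  fix x y
  assume x: "x \<in> carrier B" "x \<sqsubseteq> y" and "y \<in> {x \<in> carrier B. \<exists>i \<in> I. x \<sqsubseteq> i \<oplus> b}"
  then obtain i where y: "y \<in> carrier B" and i: "i \<in> I" "y \<sqsubseteq> i \<oplus> b" by auto
  then have "i \<oplus> b \<in> carrier B" using I b join_closed by (auto simp: ideal_def)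
  then have "x \<sqsubseteq> i \<oplus> b" using le_trans x y i by blast
  then show "x \<in> {x \<in> carrier B. \<exists>i \<in> I. x \<sqsubseteq> i \<oplus> b}" using x i by auto
next
  fix x y
  assume "x \<in> {x \<in> carrier B. \<exists>i \<in> I. x \<sqsubseteq> i \<oplus> b}" "y \<in> {x \<in> carrier B. \<exists>i \<in> I. x \<sqsubseteq> i \<oplus> b}"
  then obtain i j where x: "x \<in> carrier B" "x \<sqsubseteq> i \<oplus> b" "i \<in> I"
    and y: "y \<in> carrier B" "y \<sqsubseteq> j \<oplus> b" "j \<in> I" by auto
  have ij: "i \<oplus> j \<in> I" "i \<in> carrier B" "j \<in> carrier B"
    using I x y by (auto simp: ideal_def)
  have c: "i \<oplus> j \<in> carrier B" "(i \<oplus> j) \<oplus> b \<in> carrier B" using ij b join_closed by auto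
  have "i \<oplus> b \<sqsubseteq> (i \<oplus> j) \<oplus> b" "j \<oplus> b \<sqsubseteq> (i \<oplus> j) \<oplus> b"
    using ij b c join_upper join_upper2 le_refl by (auto intro!: join_mono)
  then have "x \<sqsubseteq> (i \<oplus> j) \<oplus> b" "y \<sqsubseteq> (i \<oplus> j) \<oplus> b"
    using le_trans x y ij b c join_closed by meson+
  then have "x \<oplus> y \<sqsubseteq> (i \<oplus> j) \<oplus> b" using join_least x y c by auto
  then show "x \<oplus> y \<in> {x \<in> carrier B. \<exists>i \<in> I. x \<sqsubseteq> i \<oplus> b}"
    using ij(1) x(1) y(1) join_closed by auto
qed auto

text \<open>Any two elements of the union already lie in a common member of the chain.\<close>

lemma ideal_Union_chain:
  assumes ideals: "\<And>I. I \<in> \<C> \<Longrightarrow> ideal I" and ne: "\<C> \<noteq> {}"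
    and chain: "\<And>I J. \<lbrakk>I \<in> \<C>; J \<in> \<C>\<rbrakk> \<Longrightarrow> I \<subseteq> J \<or> J \<subseteq> I"
  shows "ideal (\<Union>\<C>)"
  unfolding ideal_def
proof (intro conjI ballI impI)
  show "\<Union>\<C> \<subseteq> carrier B" using ideals unfolding ideal_def by blast
  show "\<zero> \<in> \<Union>\<C>" using ideals ne unfolding ideal_def by blast
next
  fix x y assume "x \<in> carrier B" "y \<in> \<Union>\<C>" "x \<sqsubseteq> y"
  then show "x \<in> \<Union>\<C>" using ideals unfolding ideal_def by blast
next
  fix x y assume "x \<in> \<Union>\<C>" "y \<in> \<Union>\<C>"
  then obtain I where "I \<in> \<C>" "x \<in> I" "y \<in> I" using chain by blast
  then show "x \<oplus> y \<in> \<Union>\<C>" using ideals unfolding ideal_def by blast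
qed

section \<open>Separation by prime filters\<close>

lemma maximal_ideal_without:
  assumes "ideal I" "a \<notin> I"
  obtains M where "ideal M" "I \<subseteq> M" "a \<notin> M"
    "\<And>J. \<lbrakk>ideal J; M \<subseteq> J; a \<notin> J\<rbrakk> \<Longrightarrow> J = M"
proof -
  let ?A = "{J. ideal J \<and> I \<subseteq> J \<and> a \<notin> J}"
  have "\<exists>M\<in>?A. \<forall>X\<in>?A. M \<subseteq> X \<longrightarrow> X = M"
  proof (rule subset_Zorn_nonempty)
    show "?A \<noteq> {}" using assms by auto
    fix \<C> assume ne: "\<C> \<noteq> {}" and ch: "subset.chain ?A \<C>"
    then have sub: "\<C> \<subseteq> ?A" and lin: "\<And>X Y. X \<in> \<C> \<Longrightarrow> Y \<in> \<C> \<Longrightarrow> X \<subseteq> Y \<or> Y \<subseteq> X"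
      unfolding subset_chain_def by auto
    have "ideal (\<Union>\<C>)" using sub ne lin by (intro ideal_Union_chain) auto
    then show "\<Union>\<C> \<in> ?A" using sub ne by auto
  qed
  then show thesis using that by auto
qed

text \<open>Upward closure and primality are the ideal axioms read in the complement.
  Down-directedness is the step that rests on maximality and distributivity.\<close>

lemma prime_filter_compl_maximal_ideal:
  assumes a: "a \<in> carrier B" and M: "ideal M" "a \<notin> M"
    and max: "\<And>J. \<lbrakk>ideal J; M \<subseteq> J; a \<notin> J\<rbrakk> \<Longrightarrow> J = M"
  shows "prime_filter (carrier B - M)"
proof -
  have sub: "M \<subseteq> carrier B" and zero: "\<zero> \<in> M"
    and down: "\<And>x y. \<lbrakk>x \<in> carrier B; y \<in> M; x \<sqsubseteq> y\<rbrakk> \<Longrightarrow> x \<in> M"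
    and closed: "\<And>x y. \<lbrakk>x \<in> M; y \<in> M\<rbrakk> \<Longrightarrow> x \<oplus> y \<in> M"
    using M(1) by (auto simp: ideal_def)
  \<comment> \<open>Otherwise the ideal generated by \<open>M\<close> and \<open>x\<close> omits
    \<open>a\<close>, so it equals \<open>M\<close> by maximality, although it contains
    \<open>x\<close>.\<close>
  have below: "\<exists>i\<in>M. a \<sqsubseteq> i \<oplus> x" if x: "x \<in> carrier B - M" for x
  proof (rule ccontr)
    assume none: "\<not> ?thesis"
    let ?J = "{z \<in> carrier B. \<exists>i \<in> M. z \<sqsubseteq> i \<oplus> x}"
    have "ideal ?J" using ideal_adjoin M(1) x by auto
    moreover have "M \<subseteq> ?J" using sub x join_upper by blast
    ultimately have "?J = M" using none max by auto
    moreover have "x \<in> ?J" using zero zero_closed x join_upper2 by auto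
    ultimately show False using x by auto
  qed
  have "\<exists>z \<in> carrier B - M. z \<sqsubseteq> x \<and> z \<sqsubseteq> y"
    if x: "x \<in> carrier B - M" and y: "y \<in> carrier B - M" for x y
  proof -
    obtain i j where i: "i \<in> M" "a \<sqsubseteq> i \<oplus> x" and j: "j \<in> M" "a \<sqsubseteq> j \<oplus> y"
      using below x y by blast
    \<comment> \<open>Distributivity is used twice: \<open>a\<close> splits into a part in
      \<open>M\<close> and a part \<open>x'\<close> below \<open>x\<close>, then \<open>x'\<close>
      splits into a part in \<open>M\<close> and a part \<open>z\<close> below \<open>y\<close>.
      This \<open>z\<close> is the common lower bound; were it in \<open>M\<close>, then
      \<open>x'\<close> and hence \<open>a\<close> would be too.\<close>
    obtain i' x' where i': "i' \<in> carrier B" "i' \<sqsubseteq> i"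
      and x': "x' \<in> carrier B" "x' \<sqsubseteq> x" and a_eq: "a = i' \<oplus> x'"
      using distributive[OF a _ _ i(2)] i sub x by blast
    have "x' \<sqsubseteq> a" using a_eq i' x' join_upper2 by auto
    then have "x' \<sqsubseteq> j \<oplus> y"
      using le_trans[OF x'(1) a _ _ j(2)] j sub y join_closed by auto
    then obtain j' z where j': "j' \<in> carrier B" "j' \<sqsubseteq> j"
      and z: "z \<in> carrier B" "z \<sqsubseteq> y" and x'_eq: "x' = j' \<oplus> z"
      using distributive[OF x'(1), of j y] j sub y by blast
    have "z \<sqsubseteq> x'" using x'_eq j' z join_upper2 by auto
    then have "z \<sqsubseteq> x" using le_trans z x' x by blast
    moreover have "z \<notin> M"
    proof
      assume "z \<in> M"
      then have "x' \<in> M" using x'_eq closed down j' j by auto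
      then have "a \<in> M" using a_eq closed down i' i by auto
      then show False using M by simp
    qed
    ultimately show ?thesis using z by auto
  qed
  moreover have "\<one> \<notin> M" using M a down le_one by auto
  moreover have "\<forall>x \<in> carrier B - M. \<forall>y \<in> carrier B. x \<sqsubseteq> y \<longrightarrow> y \<in> carrier B - M"
    using down by blast
  ultimately show ?thesis
    unfolding prime_filter_def
    using zero one_closed closed by blast
qed

text \<open>The filter is the complement of a maximal ideal that contains \<open>I\<close> and omits
  \<open>a\<close>. It is applied to principal ideals to separate elements, and to ideals of
  non-contact to realise contact.\<close>

lemma prime_filter_separation:
  assumes "ideal I" "a \<in> carrier B" "a \<notin> I"
  obtains F where "prime_filter F" "a \<in> F" "F \<inter> I = {}"
proof -
  obtain M where M: "ideal M" "I \<subseteq> M" "a \<notin> M"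
    "\<And>J. \<lbrakk>ideal J; M \<subseteq> J; a \<notin> J\<rbrakk> \<Longrightarrow> J = M"
    using maximal_ideal_without assms by blast
  have "prime_filter (carrier B - M)"
    using prime_filter_compl_maximal_ideal assms(2) M(1,3,4) by blast
  then show thesis using that M(2,3) assms(2) by blast
qed

lemma prime_filter_separates:
  assumes "a \<in> carrier B" "b \<in> carrier B" "\<not> a \<sqsubseteq> b"
  obtains F where "prime_filter F" "a \<in> F" "b \<notin> F"
proof -
  obtain F where "prime_filter F" "a \<in> F" "F \<inter> {x \<in> carrier B. x \<sqsubseteq> b} = {}"
    using prime_filter_separation[OF ideal_principal[OF assms(2)], of a] assms by blast
  then show thesis using that assms(2) le_refl by blast
qed

section \<open>Contact and prime filters\<close>

lemma contact_mono2:
  assumes "x \<in> carrier B" "y \<in> carrier B" "x' \<in> carrier B" "y' \<in> carrier B"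
    and "x \<frown> y" "x \<sqsubseteq> x'" "y \<sqsubseteq> y'"
  shows "x' \<frown> y'"
proof -
  have "x \<frown> y'" using contact_mono assms by blast
  then have "y' \<frown> x" using contact_sym assms by blast
  then have "y' \<frown> x'" using contact_mono assms by blast
  then show ?thesis using contact_sym assms by blast
qed

text \<open>A common lower bound in \<open>F\<close> is nonzero, hence in contact with itself, and
  contact passes up to \<open>x\<close> and \<open>y\<close>. This makes \<open>spectrum_rel\<close>
  reflexive.\<close>

lemma prime_filter_contact:
  assumes F: "prime_filter F" and xy: "x \<in> F" "y \<in> F"
  shows "x \<frown> y"
proof -
  obtain z where "z \<in> F" "z \<sqsubseteq> x" "z \<sqsubseteq> y" using F xy unfolding prime_filter_def by blast
  moreover have "F \<subseteq> carrier B" "\<zero> \<notin> F" using F by (auto simp: prime_filter_def)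
  ultimately show ?thesis using contact_refl xy contact_mono2[of z z x y] by blast
qed

lemma not_contact_zero: "x \<in> carrier B \<Longrightarrow> \<not> x \<frown> \<zero>"
  using contact_nonzero contact_sym zero_closed by blast

text \<open>If \<open>c\<close> is not in contact with \<open>x\<close> and \<open>d\<close> not
  with \<open>y\<close>, a common lower bound of \<open>c\<close> and \<open>d\<close> in
  \<open>F\<close> is in contact with neither, hence not with \<open>x \<oplus> y\<close>. Assuming
  only directedness covers both a singleton and a prime filter.\<close>

lemma ideal_not_contact:
  assumes F: "F \<subseteq> carrier B" "F \<noteq> {}"
    and dir: "\<And>x y. \<lbrakk>x \<in> F; y \<in> F\<rbrakk> \<Longrightarrow> \<exists>z \<in> F. z \<sqsubseteq> x \<and> z \<sqsubseteq> y"
  shows "ideal {d \<in> carrier B. \<exists>c \<in> F. \<not> c \<frown> d}"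
  unfolding ideal_def
proof (intro conjI ballI impI)
  show "\<zero> \<in> {d \<in> carrier B. \<exists>c \<in> F. \<not> c \<frown> d}"
    using F not_contact_zero zero_closed by blast
next
  fix x y assume "x \<in> carrier B" "y \<in> {d \<in> carrier B. \<exists>c \<in> F. \<not> c \<frown> d}" "x \<sqsubseteq> y"
  then show "x \<in> {d \<in> carrier B. \<exists>c \<in> F. \<not> c \<frown> d}"
    using F contact_mono by blast
next
  fix x y
  assume "x \<in> {d \<in> carrier B. \<exists>c \<in> F. \<not> c \<frown> d}" "y \<in> {d \<in> carrier B. \<exists>c \<in> F. \<not> c \<frown> d}"
  then obtain c d where x: "x \<in> carrier B" "c \<in> F" "\<not> c \<frown> x"
    and y: "y \<in> carrier B" "d \<in> F" "\<not> d \<frown> y" by auto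
  obtain e where e: "e \<in> F" "e \<sqsubseteq> c" "e \<sqsubseteq> d" using dir x y by blast
  have "\<not> e \<frown> x" "\<not> e \<frown> y"
    using x y e F contact_mono2 le_refl by (meson subsetD)+
  then have "\<not> e \<frown> (x \<oplus> y)" using contact_join x y e F by blast
  then show "x \<oplus> y \<in> {d \<in> carrier B. \<exists>c \<in> F. \<not> c \<frown> d}"
    using e x y join_closed by auto
qed auto

lemma contact_prime_filters:
  assumes ab: "a \<in> carrier B" "b \<in> carrier B" "a \<frown> b"
  obtains F G where "prime_filter F" "prime_filter G" "a \<in> F" "b \<in> G"
    "\<And>x y. \<lbrakk>x \<in> F; y \<in> G\<rbrakk> \<Longrightarrow> x \<frown> y"
proof -
  have "ideal {d \<in> carrier B. \<exists>c \<in> {a}. \<not> c \<frown> d}"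
    using ab le_refl by (intro ideal_not_contact) auto
  then obtain G where G: "prime_filter G" "b \<in> G"
    and "G \<inter> {d \<in> carrier B. \<exists>c \<in> {a}. \<not> c \<frown> d} = {}"
    using prime_filter_separation[of _ b] ab by auto
  moreover have G_sub: "G \<subseteq> carrier B" using G by (simp add: prime_filter_def)
  ultimately have aG: "a \<frown> c" if "c \<in> G" for c using that by blast
  have "ideal {d \<in> carrier B. \<exists>c \<in> G. \<not> c \<frown> d}"
    using G by (intro ideal_not_contact) (auto simp: prime_filter_def)
  \<comment> \<open>Every member of \<open>G\<close> is in contact with \<open>a\<close>, because
    \<open>G\<close> was chosen to avoid the elements that are not.\<close>
  moreover have "a \<notin> {d \<in> carrier B. \<exists>c \<in> G. \<not> c \<frown> d}"
    using aG contact_sym ab G_sub by auto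
  ultimately obtain F where F: "prime_filter F" "a \<in> F"
    and disj: "F \<inter> {d \<in> carrier B. \<exists>c \<in> G. \<not> c \<frown> d} = {}"
    using prime_filter_separation ab(1) by blast
  have "x \<frown> y" if "x \<in> F" "y \<in> G" for x y
  proof -
    have "x \<in> carrier B" using F that by (auto simp: prime_filter_def)
    then show ?thesis using disj that contact_sym G_sub by blast
  qed
  then show thesis using that F G by blast
qed

section \<open>The representation on the set of prime filters\<close>

definition spectrum :: "'a set set" where
  "spectrum = {F. prime_filter F}"

definition spectrum_rel :: "'a set rel" where
  "spectrum_rel = {(F, G) \<in> spectrum \<times> spectrum. \<forall>x \<in> F. \<forall>y \<in> G. x \<frown> y}"

definition stone_map :: "'a \<Rightarrow> 'a set set" where
  "stone_map a = {F \<in> spectrum. a \<in> F}"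

lemma refl_on_spectrum_rel: "refl_on spectrum spectrum_rel"
  by (auto simp: refl_on_def spectrum_rel_def spectrum_def intro: prime_filter_contact)

lemma sym_spectrum_rel: "sym spectrum_rel"
proof (rule symI)
  fix F G assume "(F, G) \<in> spectrum_rel"
  moreover from this have "F \<subseteq> carrier B" "G \<subseteq> carrier B"
    by (auto simp: spectrum_rel_def spectrum_def prime_filter_def)
  ultimately show "(G, F) \<in> spectrum_rel"
    using contact_sym unfolding spectrum_rel_def by blast
qed

text \<open>Separation by prime filters gives one direction, upward closure the other. Injectivity
  of \<open>stone_map\<close> then follows by antisymmetry.\<close>

lemma stone_map_subset_iff:
  assumes "a \<in> carrier B" "b \<in> carrier B"
  shows "stone_map a \<subseteq> stone_map b \<longleftrightarrow> a \<sqsubseteq> b"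
proof
  assume "stone_map a \<subseteq> stone_map b"
  then show "a \<sqsubseteq> b"
    using prime_filter_separates[OF assms] by (auto simp: stone_map_def spectrum_def)
next
  assume "a \<sqsubseteq> b"
  then show "stone_map a \<subseteq> stone_map b"
    using assms by (auto simp: stone_map_def spectrum_def prime_filter_def)
qed

text \<open>Primality gives the inclusion from left to right, monotonicity of
  \<open>stone_map\<close> the reverse.\<close>

lemma stone_map_join:
  assumes "a \<in> carrier B" "b \<in> carrier B"
  shows "stone_map (a \<oplus> b) = stone_map a \<union> stone_map b"
proof
  show "stone_map (a \<oplus> b) \<subseteq> stone_map a \<union> stone_map b"
    using assms by (auto simp: stone_map_def spectrum_def prime_filter_def)
  show "stone_map a \<union> stone_map b \<subseteq> stone_map (a \<oplus> b)"
    using assms join_closed join_upper join_upper2 by (simp add: stone_map_subset_iff)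
qed

lemma stone_map_contact:
  assumes "a \<in> carrier B" "b \<in> carrier B"
  shows "a \<frown> b \<longleftrightarrow> (\<exists>F \<in> stone_map a. \<exists>G \<in> stone_map b. (F, G) \<in> spectrum_rel)"
proof
  assume "a \<frown> b"
  then obtain F G where "prime_filter F" "prime_filter G" "a \<in> F" "b \<in> G"
    "\<And>x y. \<lbrakk>x \<in> F; y \<in> G\<rbrakk> \<Longrightarrow> x \<frown> y"
    using contact_prime_filters[OF assms] by blast
  then have "F \<in> stone_map a" "G \<in> stone_map b" "(F, G) \<in> spectrum_rel"
    by (auto simp: stone_map_def spectrum_def spectrum_rel_def)
  then show "\<exists>F \<in> stone_map a. \<exists>G \<in> stone_map b. (F, G) \<in> spectrum_rel" by blast
qed (auto simp: stone_map_def spectrum_rel_def)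

lemma iso_embedding_stone_map:
  "iso_embedding stone_map B (powerset_structure spectrum spectrum_rel)"
proof -
  have "inj_on stone_map (carrier B)"
    using le_antisym stone_map_subset_iff by (metis inj_onI subset_refl)
  \<comment> \<open>By definition every prime filter contains \<one> and omits \<zero>.\<close>
  moreover have "stone_map \<zero> = {}" "stone_map \<one> = spectrum" "stone_map a \<subseteq> spectrum" for a
    by (auto simp: stone_map_def spectrum_def prime_filter_def)
  ultimately show ?thesis
    unfolding iso_embedding_def powerset_structure_def
    by (simp add: stone_map_join stone_map_subset_iff flip: stone_map_contact)
qed

end

theorem mainTheorem3:
  fixes B :: "'a contact_structure"
  assumes "dcjs B"
  shows "\<exists>(W :: 'a set set) R h.
           R \<subseteq> W \<times> W \<and> refl_on W R \<and> sym R \<and>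
           iso_embedding h B (powerset_structure W R)"
proof -
  interpret dcjs B by fact
  have "spectrum_rel \<subseteq> spectrum \<times> spectrum" by (auto simp: spectrum_rel_def)
  then show ?thesis
    using refl_on_spectrum_rel sym_spectrum_rel iso_embedding_stone_map by blast
qed

end
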